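(* Let $p$ be a prime, let $\alpha_p\geq 1$ and $n\geq 1$ be integers, and let $q$ be an odd prime with $q\neq p$. Suppose that there are (not necessarily distinct) positive integers $x_1,\dots,x_n$ with $\sum_{i=1}^n \frac{1}{x_i}=1$, each $x_i$ being of the form $p^{a}q^{b}$ with integers $0\leq a\leq \alpha_p$ and $b\geq 0$ (the exponents depending on $i$), and such that $p$ divides at least one of the $x_i$ and $q$ divides at least one of the $x_i$. Then, for each integer $k$ with $1\leq k\leq\alpha_p$, $$q\leq \max\Big(p^{\alpha_p}\big((p-1)(2\alpha_p-k)+2\big)-1,\; p^{\alpha_p}\big(n-1-(p-1)(\alpha_p-k)\big)-1\Big).$$ *)

theory Defs
  imports Complex_Main "HOL-Computational_Algebra.Primes"
begin

end

theory Submission imports Defs begin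

text \<open>
  Put \<open>P = p ^ \<alpha>\<close> and multiply the equation by \<open>P\<close>: each term \<open>1 / (p ^ a * q ^ b)\<close> becomes
  \<open>w / q ^ b\<close> with the integer weight \<open>w = p ^ (\<alpha> - a) \<le> P\<close>, and these add up to \<open>P\<close>.
  Since \<open>q \<equiv> 1\<close> modulo \<open>q - 1\<close>, the sum \<open>M\<close> of the weights alone is congruent to \<open>P\<close> modulo
  \<open>q - 1\<close>; it exceeds \<open>P\<close> because some \<open>b\<close> is positive. So \<open>M = P + C (q - 1)\<close> with \<open>C \<ge> 1\<close>,
  while \<open>n \<ge> M / P\<close>.

  If \<open>C \<ge> 2\<close>, then \<open>P (n - 1) \<ge> 2 (q - 1)\<close>. This is about twice the required \<open>q + 1\<close>, and the surplus pays for
  the term \<open>(p - 1) (\<alpha> - k)\<close> as soon as \<open>q\<close> exceeds the first bound of the maximum.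

  If \<open>C = 1\<close>, there is no slack: the terms divisible by \<open>q\<close> have total weight exactly \<open>q\<close>, and the
  others have total weight \<open>P - 1\<close> (lemma \<open>weight_sum_dichotomy\<close>). All base-\<open>p\<close> digits of
  \<open>P - 1\<close> are \<open>p - 1\<close>, so at least \<open>(p - 1) \<alpha>\<close> powers of \<open>p\<close> are needed to
  produce it (lemma \<open>card_powers_sum_minus_one\<close>), and the weight \<open>q\<close>, not being a multiple of \<open>P\<close>,
  needs at least \<open>(q + 1) / P\<close> terms. Since \<open>k \<ge> 1\<close>, the first count is at least
  \<open>(p - 1) (\<alpha> - k) + 1\<close>, and adding the two counts gives the second bound.
\<close>

text \<open>
  The number \<open>t\<close> counts additional summands \<open>1\<close>; it makes the induction on \<open>\<alpha>\<close> work. There are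
  \<open>p u - 1\<close> summands equal to \<open>1\<close> for some \<open>u \<ge> 1\<close>, and dividing everything by \<open>p\<close> turns them into
  \<open>u - 1\<close> summands \<open>1\<close>, which is a loss of at least \<open>p - 1\<close> summands.
\<close>

lemma card_powers_sum_minus_one:
  fixes p t \<alpha> :: nat and e :: "'a \<Rightarrow> nat"
  assumes "p > 0" and "finite S" and "p ^ \<alpha> dvd (\<Sum>i\<in>S. p ^ e i) + t + 1"
  shows "(p - 1) * \<alpha> \<le> card S + t"
  using assms(2,3)
proof (induction \<alpha> arbitrary: S e t)
  case 0
  then show ?case by simp
next
  case (Suc \<alpha>)
  define S0 where "S0 = {i \<in> S. e i = 0}"
  define S1 where "S1 = {i \<in> S. e i \<noteq> 0}"
  have S: "S = S0 \<union> S1" "S0 \<inter> S1 = {}" "finite S0" "finite S1"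
    using Suc.prems(1) by (auto simp: S0_def S1_def)
  have "(\<Sum>i\<in>S0. p ^ e i) = card S0"
    by (simp add: S0_def)
  moreover have "(\<Sum>i\<in>S1. p ^ e i) = p * (\<Sum>i\<in>S1. p ^ (e i - 1))"
    unfolding sum_distrib_left
    by (intro sum.cong refl) (auto simp: S1_def simp flip: power_Suc)
  ultimately have sum: "(\<Sum>i\<in>S. p ^ e i) = card S0 + p * (\<Sum>i\<in>S1. p ^ (e i - 1))"
    using S by (simp add: sum.union_disjoint)
  have dvd: "p * p ^ \<alpha> dvd p * (\<Sum>i\<in>S1. p ^ (e i - 1)) + (card S0 + t + 1)"
    using Suc.prems(2) by (simp add: sum algebra_simps)
  then have "p dvd p * (\<Sum>i\<in>S1. p ^ (e i - 1)) + (card S0 + t + 1)"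
    by (rule dvd_mult_left)
  then have "p dvd card S0 + t + 1"
    using dvd_add_right_iff[OF dvd_triv_left] by blast
  then obtain u where u: "card S0 + t + 1 = p * u" by (elim dvdE)
  then obtain v where v: "u = v + 1"
    by (cases u) auto
  have "p * p ^ \<alpha> dvd p * ((\<Sum>i\<in>S1. p ^ (e i - 1)) + v + 1)"
    using dvd unfolding u v by (simp add: algebra_simps)
  then have "p ^ \<alpha> dvd (\<Sum>i\<in>S1. p ^ (e i - 1)) + v + 1"
    using \<open>p > 0\<close> by (subst (asm) nat_mult_dvd_cancel1) auto
  from Suc.IH[OF S(4) this] have IH: "(p - 1) * \<alpha> \<le> card S1 + v" .
  obtain r where r: "p = r + 1"
    using \<open>p > 0\<close> by (cases p) auto
  have "card S0 + t = r * v + v + r"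
    using u by (simp add: v r algebra_simps)
  moreover have "card S = card S0 + card S1"
    using S by (simp add: card_Un_disjoint)
  ultimately show ?case
    using IH by (simp add: r algebra_simps)
qed

text \<open>
  The excess of the total weight over \<open>P\<close> is \<open>\<Sum>i. w i * (1 - 1 / q ^ b i)\<close>, a positive multiple of
  \<open>q - 1\<close>. If it equals \<open>q - 1\<close>, the weight \<open>W\<close> of the terms with \<open>b i > 0\<close> satisfies
  \<open>W (1 - 1 / q) \<le> q - 1 < W\<close>, which leaves only \<open>W = q\<close>.
\<close>

lemma weight_sum_dichotomy:
  fixes q P :: nat and w b :: "'a \<Rightarrow> nat"
  assumes "q \<ge> 2" and "finite I" and w: "\<And>i. i \<in> I \<Longrightarrow> w i > 0"
    and sum: "(\<Sum>i\<in>I. real (w i) / real q ^ b i) = real P"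
    and ex: "\<exists>i\<in>I. b i > 0"
  shows "P + 2 * (q - 1) \<le> (\<Sum>i\<in>I. w i) \<or>
    (\<Sum>i | i \<in> I \<and> b i > 0. w i) = q \<and> (\<Sum>i | i \<in> I \<and> b i = 0. w i) + 1 = P"
proof -
  define M where "M = (\<Sum>i\<in>I. w i)"
  define J where "J = {i \<in> I. b i > 0}"
  define W where "W = (\<Sum>i\<in>J. w i)"
  have q: "real q > 1" using \<open>q \<ge> 2\<close> by simp
  have J: "finite J" "J \<noteq> {}" using \<open>finite I\<close> ex by (auto simp: J_def)
  have M: "M = W + (\<Sum>i | i \<in> I \<and> b i = 0. w i)"
  proof -
    have "(\<Sum>i\<in>J \<union> {i \<in> I. b i = 0}. w i) = W + (\<Sum>i | i \<in> I \<and> b i = 0. w i)"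
      unfolding W_def using \<open>finite I\<close> by (intro sum.union_disjoint) (auto simp: J_def)
    moreover have "J \<union> {i \<in> I. b i = 0} = I" by (auto simp: J_def)
    ultimately show ?thesis by (simp add: M_def)
  qed
  have excess: "real M - real P = real W - (\<Sum>i\<in>J. real (w i) / real q ^ b i)"
  proof -
    have "real M - real P = (\<Sum>i\<in>I. real (w i) - real (w i) / real q ^ b i)"
      by (simp add: M_def sum_subtractf sum)
    also have "\<dots> = (\<Sum>i\<in>J. real (w i) - real (w i) / real q ^ b i)"
      using \<open>finite I\<close> by (intro sum.mono_neutral_right) (auto simp: J_def)
    finally show ?thesis by (simp add: W_def sum_subtractf)
  qed
  have tail_pos: "(\<Sum>i\<in>J. real (w i) / real q ^ b i) > 0"
    using J w q by (intro sum_pos) (auto simp: J_def)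
  have tail_le: "(\<Sum>i\<in>J. real (w i) / real q ^ b i) \<le> real W / real q"
  proof -
    have "real (w i) / real q ^ b i \<le> real (w i) / real q" if "i \<in> J" for i
    proof -
      have "real q ^ 1 \<le> real q ^ b i"
        using that q by (intro power_increasing) (auto simp: J_def)
      then show ?thesis using q by (intro divide_left_mono) auto
    qed
    then show ?thesis
      by (simp add: W_def sum_divide_distrib sum_mono)
  qed
  have "W > 0" using J w unfolding W_def by (intro sum_pos) (auto simp: J_def)
  then have "real W / real q < real W"
    using q by (simp add: field_simps)
  then have "M > P" using excess tail_le by simp
  have dvd: "int q - 1 dvd int M - int P"
  proof -
    \<comment> \<open>Any common exponent \<open>B\<close> that clears all denominators will do.\<close>
    define B where "B = (\<Sum>i\<in>I. b i)"
    have bB: "b i \<le> B" if "i \<in> I" for i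
      unfolding B_def using that \<open>finite I\<close> by (simp add: member_le_sum)
    have "real P * real q ^ B = (\<Sum>i\<in>I. real (w i) / real q ^ b i * real q ^ B)"
      unfolding sum[symmetric] by (rule sum_distrib_right)
    also have "\<dots> = (\<Sum>i\<in>I. real (w i) * real q ^ (B - b i))"
      using q bB by (intro sum.cong) (auto simp: power_diff)
    also have "\<dots> = real_of_int (\<Sum>i\<in>I. int (w i) * int q ^ (B - b i))"
      by simp
    finally have "real_of_int (int P * int q ^ B) = real_of_int (\<Sum>i\<in>I. int (w i) * int q ^ (B - b i))"
      by simp
    then have "int P * int q ^ B = (\<Sum>i\<in>I. int (w i) * int q ^ (B - b i))"
      by (simp only: of_int_eq_iff)
    then have "int M - int P =
        int P * (int q ^ B - 1) - (\<Sum>i\<in>I. int (w i) * (int q ^ (B - b i) - 1))"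
      by (simp add: M_def sum_subtractf right_diff_distrib)
    moreover have "int q - 1 dvd int q ^ m - 1" for m
      by (simp add: power_diff_1_eq)
    ultimately show ?thesis
      by (simp add: dvd_diff dvd_sum)
  qed
  then obtain C where C: "int M - int P = (int q - 1) * C" by (elim dvdE)
  have "(int q - 1) * C > 0"
    using \<open>M > P\<close> C by linarith
  then have "C > 0"
    using \<open>q \<ge> 2\<close> by (simp add: zero_less_mult_iff)
  show ?thesis
  proof (cases "C = 1")
    case False
    then have "(int q - 1) * 2 \<le> (int q - 1) * C"
      using \<open>C > 0\<close> \<open>q \<ge> 2\<close> by (intro mult_left_mono) auto
    then have "int P + 2 * (int q - 1) \<le> int M" using C by linarith
    then have "int (P + 2 * (q - 1)) \<le> int M" using \<open>q \<ge> 2\<close> by (simp add: of_nat_diff)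
    then have "P + 2 * (q - 1) \<le> M" by (simp only: of_nat_le_iff)
    then show ?thesis by (simp add: M_def)
  next
    case True
    then have "int M - int P = int q - 1" using C by simp
    then have MP: "M + 1 = P + q" by linarith
    then have "real M - real P = real q - 1" by linarith
    then have eq: "real W - (\<Sum>i\<in>J. real (w i) / real q ^ b i) = real q - 1"
      using excess by linarith
    have "real q - 1 < real W" using eq tail_pos by linarith
    moreover have "real W \<le> real q"
    proof -
      have "real W - real W / real q \<le> real q - 1" using eq tail_le by linarith
      moreover have "real W - real W / real q = real W * (real q - 1) / real q"
        using q by (simp add: field_simps)
      ultimately have "real W * (real q - 1) \<le> real q * (real q - 1)"
        using q by (simp add: pos_divide_le_eq mult.commute)
      then show ?thesis using q by simp
    qed
    ultimately have "W = q" by linarith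
    with M MP show ?thesis by (simp add: W_def J_def)
  qed
qed

theorem corollary11:
  fixes p q \<alpha> n k :: nat and x :: "nat \<Rightarrow> nat"
  assumes "prime p" and "\<alpha> \<ge> 1" and "n \<ge> 1"
    and "prime q" and "odd q" and "q \<noteq> p"
    and "\<forall>i\<in>{1..n}. x i > 0"
    and "(\<Sum>i=1..n. 1 / real (x i)) = 1"
    and "\<forall>i\<in>{1..n}. \<exists>a b. a \<le> \<alpha> \<and> x i = p ^ a * q ^ b"
    and "\<exists>i\<in>{1..n}. p dvd x i"
    and "\<exists>i\<in>{1..n}. q dvd x i"
    and "1 \<le> k" and "k \<le> \<alpha>"
  shows "int q \<le> max
      (int p ^ \<alpha> * ((int p - 1) * (2 * int \<alpha> - int k) + 2) - 1)
      (int p ^ \<alpha> * (int n - 1 - (int p - 1) * (int \<alpha> - int k)) - 1)"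
proof -
  let ?I = "{1..n}"
  define P where "P = p ^ \<alpha>"
  have p: "p \<ge> 2" and q: "q \<ge> 2"
    using \<open>prime p\<close> \<open>prime q\<close> by (auto dest: prime_ge_2_nat)
  obtain a b where ab: "\<And>i. i \<in> ?I \<Longrightarrow> a i \<le> \<alpha> \<and> x i = p ^ a i * q ^ b i"
    using assms(9) by metis
  define w where "w i = p ^ (\<alpha> - a i)" for i
  have wpos: "w i > 0" for i using p by (simp add: w_def)
  have wP: "w i \<le> P" for i
    using p unfolding w_def P_def by (intro power_increasing) auto
  have wreal: "real (w i) = real P / real p ^ a i" if "i \<in> ?I" for i
  proof -
    have "real (w i) = real p ^ (\<alpha> - a i)" by (simp add: w_def)
    also have "\<dots> = real P / real p ^ a i"
      using p ab[OF that] by (simp add: P_def power_diff)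
    finally show ?thesis .
  qed
  have "(\<Sum>i\<in>?I. real (w i) / real q ^ b i) = (\<Sum>i\<in>?I. real P * (1 / real (x i)))"
    using ab by (intro sum.cong refl) (simp add: wreal)
  also have "\<dots> = real P * (\<Sum>i\<in>?I. 1 / real (x i))"
    by (rule sum_distrib_left[symmetric])
  also have "\<dots> = real P"
    using assms(8) by simp
  finally have sum: "(\<Sum>i\<in>?I. real (w i) / real q ^ b i) = real P" .
  have ex: "\<exists>i\<in>?I. b i > 0"
  proof -
    obtain i where i: "i \<in> ?I" "q dvd p ^ a i * q ^ b i" using assms(11) ab by metis
    have "\<not> q dvd p ^ a i"
      using assms(1,4,6) prime_dvd_power primes_dvd_imp_eq by blast
    then have "b i \<noteq> 0" using i(2) by (intro notI) simp
    with i(1) show ?thesis by auto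
  qed
  have P2: "P \<ge> 2"
    using p \<open>\<alpha> \<ge> 1\<close> self_le_power[of p \<alpha>] by (simp add: P_def)
  define D where "D = (int p - 1) * (int \<alpha> - int k)"
  show ?thesis
  proof (cases "int q < int P * ((int p - 1) * (2 * int \<alpha> - int k) + 2)")
    case True
    then show ?thesis by (simp add: P_def)
  next
    case large: False
    have "int q + 1 \<le> int P * (int n - 1 - D)"
      using weight_sum_dichotomy[OF q finite_atLeastAtMost wpos sum ex]
    proof (elim disjE conjE)
      assume "P + 2 * (q - 1) \<le> (\<Sum>i\<in>?I. w i)"
      also have "\<dots> \<le> n * P"
        using sum_bounded_above[of ?I w P] wP by simp
      finally have "P + 2 * (q - 1) \<le> n * P" .
      then have "int (P + 2 * (q - 1)) \<le> int (n * P)" by (simp only: of_nat_le_iff)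
      then have 1: "int P + 2 * (int q - 1) \<le> int P * int n"
        using q by (simp add: of_nat_diff mult.commute)
      have "(int p - 1) * (int \<alpha> - int k) \<le> (int p - 1) * (2 * int \<alpha> - int k)"
        using p by (intro mult_left_mono) auto
      then have "int P * (D + 2) \<le> int P * ((int p - 1) * (2 * int \<alpha> - int k) + 2)"
        unfolding D_def by (intro mult_left_mono) auto
      then have "int P * (D + 2) \<le> int q" using large by linarith
      with 1 P2 show ?thesis by (simp add: algebra_simps)
    next
      let ?J = "{i \<in> ?I. b i > 0}" and ?K = "{i \<in> ?I. b i = 0}"
      assume J: "(\<Sum>i\<in>?J. w i) = q" and K: "(\<Sum>i\<in>?K. w i) + 1 = P"
      have "card ?J + card ?K = card (?J \<union> ?K)"
        by (intro card_Un_disjoint[symmetric]) auto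
      also have "?J \<union> ?K = ?I" by auto
      finally have n: "card ?J + card ?K = n" by simp
      have "q \<le> card ?J * P"
        using sum_bounded_above[of ?J w P] wP J by simp
      moreover have "q \<noteq> card ?J * P"
      proof
        assume "q = card ?J * P"
        then have "p dvd q" using \<open>\<alpha> \<ge> 1\<close> by (simp add: P_def dvd_power)
        then show False using assms(1,4,6) primes_dvd_imp_eq by blast
      qed
      ultimately have "q + 1 \<le> card ?J * P" by simp
      then have "int (q + 1) \<le> int (card ?J * P)" by (simp only: of_nat_le_iff)
      then have 1: "int q + 1 \<le> int P * int (card ?J)" by (simp add: mult.commute)
      have "(p - 1) * \<alpha> \<le> card ?K + 0"
        using p K by (intro card_powers_sum_minus_one[where e = "\<lambda>i. \<alpha> - a i"])
          (auto simp: w_def P_def)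
      then have "int ((p - 1) * \<alpha>) \<le> int (card ?K)"
        by (simp only: of_nat_le_iff add_0_right)
      then have 2: "(int p - 1) * int \<alpha> \<le> int (card ?K)"
        using p by (simp add: of_nat_diff)
      have "(int p - 1) * int k \<ge> 1 * 1"
        using p \<open>1 \<le> k\<close> by (intro mult_mono) auto
      moreover have "D = (int p - 1) * int \<alpha> - (int p - 1) * int k"
        by (simp add: D_def right_diff_distrib)
      moreover have "int n = int (card ?J) + int (card ?K)"
        using n by linarith
      ultimately have "int (card ?J) \<le> int n - 1 - D"
        using 2 by linarith
      then have "int P * int (card ?J) \<le> int P * (int n - 1 - D)"
        by (intro mult_left_mono) auto
      with 1 show ?thesis by linarith
    qed
    then show ?thesis by (simp add: P_def D_def)
  qed
qed

end
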